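(* Let $\mathcal{H}$ be a real Hilbert space, let $F:\mathcal{H}\to\mathcal{H}$ be continuous and monotone, and suppose that the equation $F(x)=0$ has at least one solution in $\mathcal{H}$. Let $p\ge 1$ be an integer, let $x_0\in\mathcal{H}$ with $F(x_0)\neq 0$, and let $(x,v,s):[0,+\infty)\to\mathcal{H}\times\mathcal{H}\times\mathcal{H}$ be a global solution of the accelerated rescaled gradient system (defined in the context) with parameter $p$ and initial point $x_0$. Then there exists $\bar x\in\{x\in\mathcal{H}\mid F(x)=0\}$ such that $x(t)$ and $v(t)$ both converge weakly to $\bar x$ as $t\to+\infty$. In addition, $x(t)$ and $v(t)$ converge strongly (in norm) to $\bar x$ as $t\to+\infty$ if either of the following conditions holds: 1. $F=\nabla f$ where $f:\mathcal{H}\to\mathbb{R}\cup\{+\infty\}$ is convex, differentiable and inf-compact; 2. $\{x\in\mathcal{H}\mid F(x)=0\}$ has nonempty interior.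
   Context: $F$ is monotone if $\langle F(x)-F(y),x-y\rangle\ge 0$ for all $x,y\in\mathcal{H}$. A function $f$ is inf-compact if all its sublevel sets $\{x\mid f(x)\le\kappa\}$, $\kappa\in\mathbb{R}$, are relatively compact in the norm topology. The accelerated rescaled gradient system with parameter $p\in\{1,2,\ldots\}$ and initial point $x_0$ (where $F(x_0)\ne 0$) is $$\dot s(t)=-\frac{F(x(t))}{\|F(x(t))\|^{1-1/p}},\qquad v(t)=x_0+s(t),\qquad x(t)-v(t)+\frac{F(x(t))}{\|F(x(t))\|^{1-1/p}}=0,$$ with $s(0)=0$ (equivalently $v(0)=x_0$). A global solution is a triple $(x,v,s):[0,+\infty)\to\mathcal{H}\times\mathcal{H}\times\mathcal{H}$ with $s$ differentiable, $F(x(t))\neq 0$ for all $t$ (so that the expressions make sense), satisfying these relations for all $t\ge0$. For $p=1$ the factor $\|F(x(t))\|^{1-1/p}$ is $1$. *)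

theory Defs
  imports "HOL-Analysis.Analysis"
begin

definition monotone_operator :: "('a::real_inner \<Rightarrow> 'a) \<Rightarrow> bool" where
  "monotone_operator F \<longleftrightarrow> (\<forall>x y. inner (F x - F y) (x - y) \<ge> 0)"

(* Convergence in the weak topology of a real Hilbert space, with the continuous
   linear functionals represented by inner products. *)
definition weakly_tendsto :: "('b \<Rightarrow> 'a::real_inner) \<Rightarrow> 'a \<Rightarrow> 'b filter \<Rightarrow> bool" where
  "weakly_tendsto u l G \<longleftrightarrow> (\<forall>y. ((\<lambda>t. inner (u t) y) \<longlongrightarrow> inner l y) G)"

(* Functions with values in the reals together with plus infinity are rendered as
   ereal-valued functions that never take the value minus infinity. The weight u
   ranges over the open unit interval, so no product 0 * \<infinity> occurs. *)
definition convex_ereal :: "('a::real_vector \<Rightarrow> ereal) \<Rightarrow> bool" where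
  "convex_ereal f \<longleftrightarrow>
     (\<forall>x. f x \<noteq> - \<infinity>) \<and>
     (\<forall>x y. \<forall>u\<in>{0<..<1::real}.
        f ((1 - u) *\<^sub>R x + u *\<^sub>R y) \<le> ereal (1 - u) * f x + ereal u * f y)"

(* f is finite near x and (Frechet) differentiable at x with gradient g;
   the finiteness condition is needed because real_of_ereal sends infinity to 0. *)
definition has_gradient_at :: "('a::real_inner \<Rightarrow> ereal) \<Rightarrow> 'a \<Rightarrow> 'a \<Rightarrow> bool" where
  "has_gradient_at f g x \<longleftrightarrow>
     (\<forall>\<^sub>F y in nhds x. \<bar>f y\<bar> \<noteq> \<infinity>) \<and> GDERIV (\<lambda>y. real_of_ereal (f y)) x :> g"

definition inf_compact :: "('a::topological_space \<Rightarrow> ereal) \<Rightarrow> bool" where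
  "inf_compact f \<longleftrightarrow> (\<forall>\<kappa>::real. compact (closure {x. f x \<le> ereal \<kappa>}))"

(* F(x) / norm(F(x))^(1 - 1/p); for p = 1 and F(x) nonzero the denominator is
   norm (F x) powr 0 = 1. *)
definition rescaled :: "nat \<Rightarrow> ('a::real_normed_vector \<Rightarrow> 'a) \<Rightarrow> 'a \<Rightarrow> 'a" where
  "rescaled p F x = F x /\<^sub>R (norm (F x) powr (1 - 1 / real p))"

(* The trajectories are total functions on the reals, but only their values on
   [0, \<infinity>) are constrained; the derivative at time 0 is one-sided. *)
definition arg_global_solution ::
  "nat \<Rightarrow> ('a::real_normed_vector \<Rightarrow> 'a) \<Rightarrow> 'a \<Rightarrow>
   (real \<Rightarrow> 'a) \<Rightarrow> (real \<Rightarrow> 'a) \<Rightarrow> (real \<Rightarrow> 'a) \<Rightarrow> bool" where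
  "arg_global_solution p F x0 x v s \<longleftrightarrow>
     s 0 = 0 \<and>
     (\<forall>t\<ge>0. F (x t) \<noteq> 0 \<and>
        (s has_vector_derivative - rescaled p F (x t)) (at t within {0..}) \<and>
        v t = x0 + s t \<and>
        x t - v t + rescaled p F (x t) = 0)"

end

theory Submission
  imports Defs
begin

text \<open>Write \<open>r = rescaled p F x\<close>, so that \<open>v' = - r\<close>, \<open>x = v - r\<close> and \<open>F x = norm r ^ (p - 1) *\<^sub>R r\<close>.
  Monotonicity gives \<open>(norm (v - z)\<^sup>2)' \<le> - 2 * (norm r)\<^sup>2\<close> for every zero \<open>z\<close> of \<open>F\<close>, and it makes \<open>r\<close> a
  Lipschitz function of \<open>v\<close>, hence of time; therefore \<open>r\<close>, \<open>F x\<close> and \<open>x - v\<close> tend to 0. By Minty's argument the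
  asymptotic centers of \<open>v\<close> are zeros of \<open>F\<close>, and Opial's argument yields weak convergence. If the zeros
  have an interior point, Fejer monotonicity makes \<open>v\<close> Cauchy; if \<open>F\<close> is the gradient of an inf-compact convex
  \<open>f\<close>, then \<open>f\<close> is bounded along \<open>x\<close>, so \<open>x\<close> stays in a compact set, where weak convergence is strong.\<close>

subsection \<open>Opial's lemma without weak compactness\<close>

text \<open>By Hahn-Banach these are the points lying in the closed convex hull of \<open>u ` S\<close> for every \<open>S\<close> that is
  eventual in \<open>G\<close>. They replace weak cluster points: for bounded \<open>u\<close> one exists by completeness alone
  (the asymptotic center, minimizing the eventual radius), with no need for weak compactness.\<close>

definition asymptotic_hull_point :: "('b \<Rightarrow> 'a::real_inner) \<Rightarrow> 'b filter \<Rightarrow> 'a \<Rightarrow> bool" where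
  "asymptotic_hull_point u G c \<longleftrightarrow> (\<forall>d. \<forall>\<beta>>0. \<exists>\<^sub>F t in G. inner (u t - c) d < \<beta>)"

text \<open>The parallelogram law. Its negative last term forces near-minimizers of the eventual
  radius to be close to each other.\<close>

lemma norm_midpoint_diff_sq:
  fixes u y z :: "'a::real_inner"
  shows "(norm (u - (1/2) *\<^sub>R (y + z)))\<^sup>2 = ((norm (u - y))\<^sup>2 + (norm (u - z))\<^sup>2) / 2 - (norm (y - z))\<^sup>2 / 4"
  by (simp add: power2_norm_eq_inner inner_diff_left inner_diff_right inner_add_left inner_add_right
      inner_commute field_simps)

text \<open>Centers \<open>y n\<close> whose eventual radius approaches the infimum \<open>m\<close>
  form a Cauchy sequence by the parallelogram law; their limit \<open>c\<close> is the asymptotic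
  center. If \<open>inner (u t - c) d\<close> were eventually at least \<open>\<beta>\<close>,
  moving \<open>c\<close> slightly along \<open>d\<close> would push the radius below
  \<open>m\<close>.\<close>

lemma asymptotic_hull_point_exists:
  fixes u :: "'b \<Rightarrow> 'a::{real_inner, complete_space}"
  assumes G: "G \<noteq> bot" and bdd: "\<forall>\<^sub>F t in G. norm (u t) \<le> B"
  shows "\<exists>c. asymptotic_hull_point u G c"
proof -
  define M where "M = {b. \<exists>y. \<forall>\<^sub>F t in G. norm (u t - y) \<le> b}"
  define m where "m = Inf M"
  have M_nonneg: "b \<ge> 0" if "b \<in> M" for b
  proof -
    from that obtain y where "\<forall>\<^sub>F t in G. norm (u t - y) \<le> b" by (auto simp: M_def)
    from eventually_happens'[OF G this] show ?thesis by (meson norm_ge_zero order_trans)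
  qed
  have "B \<in> M" unfolding M_def using bdd by (auto intro!: exI[of _ 0])
  have M_bdd: "bdd_below M" using M_nonneg by (auto intro!: bdd_belowI)
  have m_le: "m \<le> b" if "b \<in> M" for b unfolding m_def by (rule cInf_lower[OF that M_bdd])
  have m0: "m \<ge> 0" unfolding m_def using \<open>B \<in> M\<close> M_nonneg by (intro cInf_greatest) auto
  \<comment> \<open>Minimality of \<open>m\<close> for squared radii, the form in which both the
    midpoint and the shifted center contradict it or are constrained by it.\<close>
  have m_sq: "m\<^sup>2 \<le> k" if "\<forall>\<^sub>F t in G. (norm (u t - y))\<^sup>2 \<le> k" for y k
  proof -
    have "\<forall>\<^sub>F t in G. norm (u t - y) \<le> sqrt k"
      using that by eventually_elim (simp add: real_le_rsqrt)
    then have "sqrt k \<in> M" by (auto simp: M_def)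
    then have "m \<le> sqrt k" by (rule m_le)
    then have "m\<^sup>2 \<le> (sqrt k)\<^sup>2" using m0 by (rule power_mono)
    moreover have "k \<ge> 0" using eventually_happens'[OF G that] by (meson order_trans zero_le_power2)
    ultimately show ?thesis by simp
  qed
  have close: "(norm (y - z))\<^sup>2 \<le> 4 * (b\<^sup>2 - m\<^sup>2)"
    if "\<forall>\<^sub>F t in G. norm (u t - y) \<le> b" "\<forall>\<^sub>F t in G. norm (u t - z) \<le> b" for y z b
  proof -
    have "\<forall>\<^sub>F t in G. (norm (u t - (1/2) *\<^sub>R (y + z)))\<^sup>2 \<le> b\<^sup>2 - (norm (y - z))\<^sup>2 / 4"
      using that
    proof eventually_elim
      case (elim t)
      have "(norm (u t - y))\<^sup>2 \<le> b\<^sup>2" "(norm (u t - z))\<^sup>2 \<le> b\<^sup>2"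
        using elim by (auto intro: power_mono)
      then show ?case unfolding norm_midpoint_diff_sq by (simp add: field_simps)
    qed
    from m_sq[OF this] show ?thesis by simp
  qed
  have near: "\<exists>y. \<forall>\<^sub>F t in G. norm (u t - y) \<le> b" if "b > m" for b
  proof -
    obtain b' where "b' \<in> M" "b' < b"
      using cInf_lessD[of M b] \<open>B \<in> M\<close> \<open>b > m\<close> by (auto simp: m_def)
    then obtain y where "\<forall>\<^sub>F t in G. norm (u t - y) \<le> b'" by (auto simp: M_def)
    then have "\<forall>\<^sub>F t in G. norm (u t - y) \<le> b"
      by (rule eventually_mono) (use \<open>b' < b\<close> in auto)
    then show ?thesis by blast
  qed
  define b where "b n = m + 1 / real (Suc n)" for n
  have "\<forall>n. \<exists>y. \<forall>\<^sub>F t in G. norm (u t - y) \<le> b n"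
    by (intro allI near) (simp add: b_def)
  then obtain y where y: "\<And>n. \<forall>\<^sub>F t in G. norm (u t - y n) \<le> b n" by metis
  have b_mono: "b n \<le> b k" if "k \<le> n" for k n using that by (simp add: b_def field_simps)
  have b_lim: "b \<longlonglongrightarrow> m"
    unfolding b_def using tendsto_add[OF tendsto_const LIMSEQ_inverse_real_of_nat, of m]
    by (simp add: inverse_eq_divide)
  have "Cauchy y"
  proof (rule CauchyI)
    fix e :: real assume e: "e > 0"
    have "(\<lambda>n. 4 * ((b n)\<^sup>2 - m\<^sup>2)) \<longlonglongrightarrow> 4 * (m\<^sup>2 - m\<^sup>2)" by (intro tendsto_intros b_lim)
    then have "\<forall>\<^sub>F n in sequentially. 4 * ((b n)\<^sup>2 - m\<^sup>2) < e\<^sup>2"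
      by (rule order_tendstoD) (use e in simp)
    then obtain N where N: "4 * ((b N)\<^sup>2 - m\<^sup>2) < e\<^sup>2" by (auto simp: eventually_sequentially)
    have le_N: "\<forall>\<^sub>F t in G. norm (u t - y n) \<le> b N" if "n \<ge> N" for n
      using y[of n] by eventually_elim (use b_mono[OF that] in linarith)
    show "\<exists>N. \<forall>k\<ge>N. \<forall>n\<ge>N. norm (y k - y n) < e"
    proof (intro exI allI impI)
      fix k n assume "k \<ge> N" "n \<ge> N"
      then have "(norm (y k - y n))\<^sup>2 < e\<^sup>2" using close[OF le_N le_N] N by fastforce
      then show "norm (y k - y n) < e" by (rule power_less_imp_less_base) (use e in simp)
    qed
  qed
  then obtain c where c: "y \<longlonglongrightarrow> c" using Cauchy_convergent convergent_def by blast
  have c_near: "\<forall>\<^sub>F t in G. norm (u t - c) \<le> a" if "a > m" for a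
  proof -
    have "(\<lambda>n. b n + norm (y n - c)) \<longlonglongrightarrow> m + norm (c - c)" by (intro tendsto_intros b_lim c)
    then have "\<forall>\<^sub>F n in sequentially. b n + norm (y n - c) < a"
      by (rule order_tendstoD) (use that in simp)
    then obtain n where n: "b n + norm (y n - c) < a" by (auto simp: eventually_sequentially)
    show ?thesis using y[of n]
    proof eventually_elim
      case (elim t)
      have "norm (u t - c) \<le> norm (u t - y n) + norm (y n - c)" by norm
      then show ?case using elim n by linarith
    qed
  qed
  have "asymptotic_hull_point u G c"
    unfolding asymptotic_hull_point_def
  proof (intro allI impI)
    fix d and \<beta> :: real assume \<beta>: "\<beta> > 0"
    show "\<exists>\<^sub>F t in G. inner (u t - c) d < \<beta>"
    proof (rule ccontr)
      assume "\<not> (\<exists>\<^sub>F t in G. inner (u t - c) d < \<beta>)"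
      then have ev: "\<forall>\<^sub>F t in G. inner (u t - c) d \<ge> \<beta>" by (simp add: not_frequently not_less)
      have "d \<noteq> 0" using eventually_happens'[OF G ev] \<beta> by auto
      \<comment> \<open>This minimizes \<open>\<epsilon>\<^sup>2 * (norm d)\<^sup>2 - 2 * \<epsilon>
        * \<beta>\<close>, the bound on the change of the squared radius; the minimum is
        \<open>- \<epsilon> * \<beta>\<close>.\<close>
      define \<epsilon> where "\<epsilon> = \<beta> / (norm d)\<^sup>2"
      have \<epsilon>: "\<epsilon> > 0" "\<epsilon> * (norm d)\<^sup>2 = \<beta>" using \<beta> \<open>d \<noteq> 0\<close> by (auto simp: \<epsilon>_def)
      have "m\<^sup>2 \<le> (b n)\<^sup>2 - \<epsilon> * \<beta>" for n
      proof (rule m_sq[where y="c + \<epsilon> *\<^sub>R d"])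
        have "b n > m" by (simp add: b_def)
        from c_near[OF this] ev
        show "\<forall>\<^sub>F t in G. (norm (u t - (c + \<epsilon> *\<^sub>R d)))\<^sup>2 \<le> (b n)\<^sup>2 - \<epsilon> * \<beta>"
        proof eventually_elim
          case (elim t)
          have "\<epsilon> * \<beta> \<le> \<epsilon> * inner (u t - c) d" using elim \<epsilon> by simp
          have "(norm (u t - c))\<^sup>2 \<le> (b n)\<^sup>2" using elim by (intro power_mono) auto
          have "(norm (u t - (c + \<epsilon> *\<^sub>R d)))\<^sup>2 = (norm (u t - c))\<^sup>2 - 2 * \<epsilon> * inner (u t - c) d + \<epsilon> * (\<epsilon> * (norm d)\<^sup>2)"
            by (simp add: power2_norm_eq_inner inner_diff_left inner_diff_right inner_add_left
                inner_add_right inner_commute algebra_simps)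
          also have "\<dots> = (norm (u t - c))\<^sup>2 - 2 * (\<epsilon> * inner (u t - c) d) + \<epsilon> * \<beta>" using \<epsilon> by simp
          finally show ?case using \<open>\<epsilon> * \<beta> \<le> \<epsilon> * inner (u t - c) d\<close> \<open>(norm (u t - c))\<^sup>2 \<le> (b n)\<^sup>2\<close> by linarith
        qed
      qed
      moreover have "(\<lambda>n. (b n)\<^sup>2 - \<epsilon> * \<beta>) \<longlonglongrightarrow> m\<^sup>2 - \<epsilon> * \<beta>" by (intro tendsto_intros b_lim)
      ultimately have "m\<^sup>2 \<le> m\<^sup>2 - \<epsilon> * \<beta>" by (intro LIMSEQ_le_const) auto
      moreover have "\<epsilon> * \<beta> > 0" using \<epsilon>(1) \<beta> by simp
      ultimately show False by linarith
    qed
  qed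
  then show ?thesis by blast
qed

text \<open>A limit in direction \<open>d\<close> cannot exceed \<open>inner c d\<close>, since
  values below \<open>inner c d + \<beta>\<close> recur for every \<open>\<beta> > 0\<close>.
  Direction \<open>- d\<close> gives the reverse inequality.\<close>

lemma asymptotic_hull_point_inner_limit:
  assumes hull: "asymptotic_hull_point u G c"
    and lim: "((\<lambda>t. inner (u t) d) \<longlongrightarrow> l) G"
  shows "l = inner c d"
proof (rule antisym)
  have *: "l \<le> inner c d" if "((\<lambda>t. inner (u t) d) \<longlongrightarrow> l) G" for d l
  proof (rule ccontr)
    assume "\<not> l \<le> inner c d"
    then have pos: "(l - inner c d) / 2 > 0" by simp
    have "\<forall>\<^sub>F t in G. inner (u t) d > (l + inner c d) / 2"
      by (rule order_tendstoD[OF that]) (use pos in simp)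
    moreover have "\<exists>\<^sub>F t in G. inner (u t - c) d < (l - inner c d) / 2"
      using hull pos unfolding asymptotic_hull_point_def by blast
    ultimately have "\<exists>\<^sub>F t in G. inner (u t - c) d < (l - inner c d) / 2 \<and> inner (u t) d > (l + inner c d) / 2"
      using frequently_eventually_frequently by fast
    then show False
      by (auto dest!: frequently_ex simp: inner_diff_left field_simps)
  qed
  show "l \<le> inner c d" by (rule *[OF lim])
  have "((\<lambda>t. inner (u t) (- d)) \<longlongrightarrow> - l) G" using tendsto_minus[OF lim] by simp
  from *[OF this] show "inner c d \<le> l" by simp
qed

text \<open>Convergence of the distances to \<open>Z\<close> makes the hull point unique, even along
  finer filters. A direction in which weak convergence to \<open>c\<close> failed would single out a
  finer filter that has a hull point different from \<open>c\<close>; this is why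
  \<open>hull_Z\<close> ranges over all \<open>G' \<le> G\<close>.\<close>

lemma opial_weak_limit:
  fixes u :: "'b \<Rightarrow> 'a::{real_inner, complete_space}"
  assumes G: "G \<noteq> bot" and "Z \<noteq> {}"
    and dist_lim: "\<And>z. z \<in> Z \<Longrightarrow> \<exists>l. ((\<lambda>t. norm (u t - z)) \<longlongrightarrow> l) G"
    and hull_Z: "\<And>G' c. G' \<noteq> bot \<Longrightarrow> G' \<le> G \<Longrightarrow> asymptotic_hull_point u G' c \<Longrightarrow> c \<in> Z"
  shows "\<exists>c\<in>Z. weakly_tendsto u c G"
proof -
  obtain z0 where "z0 \<in> Z" using \<open>Z \<noteq> {}\<close> by blast
  obtain l0 where l0: "((\<lambda>t. norm (u t - z0)) \<longlongrightarrow> l0) G" using dist_lim[OF \<open>z0 \<in> Z\<close>] by blast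
  have "\<forall>\<^sub>F t in G. norm (u t - z0) < l0 + 1" by (rule order_tendstoD[OF l0]) simp
  then have bdd: "\<forall>\<^sub>F t in G. norm (u t) \<le> l0 + 1 + norm z0"
  proof eventually_elim
    case (elim t)
    have "norm (u t) \<le> norm (u t - z0) + norm z0" by norm
    then show ?case using elim by linarith
  qed
  obtain c where c: "asymptotic_hull_point u G c" using asymptotic_hull_point_exists[OF G bdd] by blast
  have "c \<in> Z" using hull_Z[OF G order_refl c] .
  have same: "c' = c" if G': "G' \<noteq> bot" "G' \<le> G" and c': "asymptotic_hull_point u G' c'" for G' c'
  proof -
    have "c' \<in> Z" using hull_Z[OF G' c'] .
    obtain l l' where l: "((\<lambda>t. norm (u t - c)) \<longlongrightarrow> l) G" and l': "((\<lambda>t. norm (u t - c')) \<longlongrightarrow> l') G"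
      using dist_lim[OF \<open>c \<in> Z\<close>] dist_lim[OF \<open>c' \<in> Z\<close>] by blast
    define L where "L = (l'\<^sup>2 - l\<^sup>2 + (norm c)\<^sup>2 - (norm c')\<^sup>2) / 2"
    \<comment> \<open>The quadratic terms in \<open>w\<close> cancel, so convergence of both
      distances yields convergence of \<open>u\<close> in the direction
      \<open>c - c'\<close>.\<close>
    have eq: "((norm (w - c'))\<^sup>2 - (norm (w - c))\<^sup>2 + (norm c)\<^sup>2 - (norm c')\<^sup>2) / 2 = inner w (c - c')" for w
      by (simp add: power2_norm_eq_inner inner_diff_left inner_diff_right inner_commute)
    have "((\<lambda>t. ((norm (u t - c'))\<^sup>2 - (norm (u t - c))\<^sup>2 + (norm c)\<^sup>2 - (norm c')\<^sup>2) / 2) \<longlongrightarrow> L) G"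
      unfolding L_def by (intro tendsto_intros l l') simp
    then have lim: "((\<lambda>t. inner (u t) (c - c')) \<longlongrightarrow> L) G" by (simp only: eq)
    have "inner c (c - c') = inner c' (c - c')"
      using asymptotic_hull_point_inner_limit[OF c lim]
        asymptotic_hull_point_inner_limit[OF c' tendsto_mono[OF G'(2) lim]] by simp
    then have "inner (c - c') (c - c') = 0" by (simp add: inner_diff_left)
    then show ?thesis by simp
  qed
  have upper: "\<forall>\<^sub>F t in G. inner (u t - c) d < \<alpha>" if "\<alpha> > 0" for \<alpha> d
  proof (rule ccontr)
    \<comment> \<open>Restricting \<open>G\<close> to the times of failure excludes \<open>c\<close>
      as a hull point, although \<open>same\<close> forces every hull point to be
      \<open>c\<close>.\<close>
    define S where "S = {t. \<not> inner (u t - c) d < \<alpha>}"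
    assume "\<not> ?thesis"
    then have ne: "inf G (principal S) \<noteq> bot"
      by (simp add: S_def trivial_limit_def eventually_inf_principal)
    have "\<forall>\<^sub>F t in inf G (principal S). norm (u t) \<le> l0 + 1 + norm z0"
      using bdd by (rule filter_leD[OF inf_le1])
    then obtain c' where c': "asymptotic_hull_point u (inf G (principal S)) c'"
      using asymptotic_hull_point_exists[OF ne] by blast
    have "c' = c" by (rule same[OF ne inf_le1 c'])
    with c' \<open>\<alpha> > 0\<close> have "\<exists>\<^sub>F t in inf G (principal S). inner (u t - c) d < \<alpha>"
      unfolding asymptotic_hull_point_def by blast
    then show False by (auto simp: S_def frequently_def eventually_inf_principal)
  qed
  have "((\<lambda>t. inner (u t) d) \<longlongrightarrow> inner c d) G" for d
  proof (rule tendstoI)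
    fix e :: real assume "e > 0"
    from upper[OF this, of d] upper[OF this, of "- d"]
    show "\<forall>\<^sub>F t in G. dist (inner (u t) d) (inner c d) < e"
      by eventually_elim (auto simp: dist_real_def inner_diff_left)
  qed
  with \<open>c \<in> Z\<close> show ?thesis unfolding weakly_tendsto_def by blast
qed

text \<open>The half-space \<open>U y\<close>, bounded by the perpendicular bisector of
  \<open>l\<close> and \<open>y\<close>, contains \<open>y\<close> and is eventually left by
  \<open>u\<close>. Finitely many of them cover the part of \<open>K\<close> outside a ball around
  \<open>l\<close>.\<close>

lemma weakly_tendsto_in_compact_imp_tendsto:
  fixes u :: "'b \<Rightarrow> 'a::real_inner"
  assumes weak: "weakly_tendsto u l G" and K: "compact K" and inK: "\<forall>\<^sub>F t in G. u t \<in> K"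
  shows "(u \<longlongrightarrow> l) G"
proof (rule tendstoI)
  fix e :: real assume e: "e > 0"
  define U where "U y = {w. inner w (y - l) > (inner l (y - l) + inner y (y - l)) / 2}" for y
  have op: "open (U y)" for y
    unfolding U_def by (intro open_Collect_less continuous_intros)
  have cmp: "compact (K - ball l e)" by (intro compact_diff K open_ball)
  have mem: "y \<in> U y" and mid: "inner l (y - l) < (inner l (y - l) + inner y (y - l)) / 2" if "y \<in> K - ball l e" for y
  proof -
    have "inner (y - l) (y - l) > 0" using that e by auto
    then show "y \<in> U y" "inner l (y - l) < (inner l (y - l) + inner y (y - l)) / 2"
      by (auto simp: U_def inner_diff_left)
  qed
  have "K - ball l e \<subseteq> (\<Union>y\<in>K - ball l e. U y)" using mem by blast
  from compactE_image[OF cmp op this]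
  obtain T where T: "T \<subseteq> K - ball l e" "finite T" "K - ball l e \<subseteq> (\<Union>y\<in>T. U y)" by auto
  have "\<forall>\<^sub>F t in G. u t \<notin> U y" if "y \<in> T" for y
  proof -
    have "((\<lambda>t. inner (u t) (y - l)) \<longlongrightarrow> inner l (y - l)) G" using weak by (simp add: weakly_tendsto_def)
    from order_tendstoD(2)[OF this mid] that T(1)
    have "\<forall>\<^sub>F t in G. inner (u t) (y - l) < (inner l (y - l) + inner y (y - l)) / 2" by blast
    then show ?thesis by eventually_elim (auto simp: U_def)
  qed
  then have "\<forall>\<^sub>F t in G. \<forall>y\<in>T. u t \<notin> U y" by (intro eventually_ball_finite T) auto
  with inK show "\<forall>\<^sub>F t in G. dist (u t) l < e"
  proof eventually_elim
    case (elim t)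
    then have "u t \<in> ball l e" using T(3) by blast
    then show ?case by (simp add: dist_commute)
  qed
qed

subsection \<open>Monotone operators and gradients of convex functions\<close>

text \<open>Minty's trick: test with \<open>y = c - s *\<^sub>R F c\<close>, divide by
  \<open>s > 0\<close> and let \<open>s\<close> tend to 0, which gives
  \<open>inner (F c) (F c) \<le> 0\<close>.\<close>

lemma minty_zero:
  fixes F :: "'a::real_inner \<Rightarrow> 'a"
  assumes cont: "continuous_on UNIV F" and ineq: "\<And>y. inner (F y) (y - c) \<ge> 0"
  shows "F c = 0"
proof -
  have le: "inner (F (c - s *\<^sub>R F c)) (F c) \<le> 0" if "s > 0" for s
    using ineq[of "c - s *\<^sub>R F c"] that by (simp add: mult_le_0_iff)
  have "isCont F c" using cont by (simp add: continuous_on_eq_continuous_at)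
  moreover have "((\<lambda>s. c - s *\<^sub>R F c) \<longlongrightarrow> c) (at_right (0::real))"
    by (rule tendsto_eq_intros refl)+ simp
  ultimately have "((\<lambda>s. F (c - s *\<^sub>R F c)) \<longlongrightarrow> F c) (at_right (0::real))"
    by (rule isCont_tendsto_compose)
  then have "((\<lambda>s. inner (F (c - s *\<^sub>R F c)) (F c)) \<longlongrightarrow> inner (F c) (F c)) (at_right (0::real))"
    by (intro tendsto_intros)
  moreover have "\<forall>\<^sub>F s in at_right (0::real). inner (F (c - s *\<^sub>R F c)) (F c) \<le> 0"
    using eventually_at_right_less[of "0::real"] by eventually_elim (rule le)
  ultimately have "inner (F c) (F c) \<le> 0" by (rule tendsto_upperbound) simp
  then show ?thesis by (metis inner_gt_zero_iff not_le)
qed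

text \<open>Monotonicity at \<open>y\<close> and \<open>x t\<close> bounds
  \<open>inner (F y) (y - v t)\<close> below by a vanishing quantity. The hull property in direction
  \<open>- F y\<close> passes this bound to \<open>c\<close>, and \<open>minty_zero\<close>
  applies.\<close>

lemma asymptotic_hull_point_zero:
  fixes F :: "'a::real_inner \<Rightarrow> 'a"
  assumes cont: "continuous_on UNIV F" and mono: "monotone_operator F"
    and hull: "asymptotic_hull_point v G c"
    and xv: "((\<lambda>t. x t - v t) \<longlongrightarrow> 0) G" and Fx: "((\<lambda>t. F (x t)) \<longlongrightarrow> 0) G"
    and bdd: "\<forall>\<^sub>F t in G. norm (x t) \<le> B"
  shows "F c = 0"
proof (rule minty_zero[OF cont])
  fix y
  show "inner (F y) (y - c) \<ge> 0"
  proof (rule ccontr)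
    assume neg: "\<not> inner (F y) (y - c) \<ge> 0"
    \<comment> \<open>Collects the errors from replacing \<open>x t\<close> by \<open>v t\<close>
      and from discarding \<open>F (x t)\<close>.\<close>
    define h where "h t = inner (F y) (x t - v t) - norm (F (x t)) * (norm y + B)" for t
    \<comment> \<open>Half the gap: the error \<open>h\<close> and the hull property each consume
      less than one \<open>\<eta>\<close>.\<close>
    define \<eta> where "\<eta> = - (inner (F y) (y - c)) / 2"
    have \<eta>: "\<eta> > 0" using neg by (simp add: \<eta>_def)
    have "(h \<longlongrightarrow> inner (F y) 0 - norm (0::'a) * (norm y + B)) G"
      unfolding h_def by (intro tendsto_intros xv Fx)
    then have "(h \<longlongrightarrow> 0) G" by simp
    then have "\<forall>\<^sub>F t in G. h t > - \<eta>" by (rule order_tendstoD) (use \<eta> in simp)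
    with bdd have "\<forall>\<^sub>F t in G. inner (F y) (y - v t) > - \<eta>"
    proof eventually_elim
      case (elim t)
      have "inner (F y - F (x t)) (y - x t) \<ge> 0" using mono by (simp add: monotone_operator_def)
      then have "inner (F y) (y - x t) \<ge> inner (F (x t)) (y - x t)" by (simp add: inner_diff_left)
      moreover have "\<bar>inner (F (x t)) (y - x t)\<bar> \<le> norm (F (x t)) * norm (y - x t)"
        by (rule Cauchy_Schwarz_ineq2)
      moreover have "norm (F (x t)) * norm (y - x t) \<le> norm (F (x t)) * (norm y + B)"
        using elim norm_triangle_ineq4[of y "x t"] by (intro mult_left_mono norm_ge_zero) linarith
      ultimately have "inner (F y) (y - x t) \<ge> - (norm (F (x t)) * (norm y + B))" by linarith
      then show ?case using elim by (simp add: h_def inner_diff_right)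
    qed
    moreover have "\<exists>\<^sub>F t in G. inner (v t - c) (- F y) < \<eta>"
      using hull \<eta> unfolding asymptotic_hull_point_def by blast
    ultimately obtain t where "inner (v t - c) (- F y) < \<eta>" "inner (F y) (y - v t) > - \<eta>"
      using frequently_eventually_frequently frequentlyE by (smt (verit))
    then show False
      by (simp add: \<eta>_def inner_diff_left inner_diff_right inner_commute field_simps)
  qed
qed

text \<open>By convexity the difference quotients from \<open>x\<close> towards \<open>z\<close> are
  at most \<open>g z - g x\<close>; their limit at 0 from the right is the directional
  derivative.\<close>

lemma convex_ereal_above_tangent:
  fixes f :: "'a::real_inner \<Rightarrow> ereal"
  assumes conv: "convex_ereal f" and fin: "\<And>z. \<bar>f z\<bar> \<noteq> \<infinity>" and grad: "has_gradient_at f w x"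
  shows "real_of_ereal (f x) + inner w (z - x) \<le> real_of_ereal (f z)"
proof -
  define g where "g y = real_of_ereal (f y)" for y
  have f_eq: "f y = ereal (g y)" for y using fin[of y] by (simp add: g_def ereal_real)
  have conv_g: "g ((1 - u) *\<^sub>R x + u *\<^sub>R z) \<le> (1 - u) * g x + u * g z" if "0 < u" "u < 1" for u
  proof -
    have "f ((1 - u) *\<^sub>R x + u *\<^sub>R z) \<le> ereal (1 - u) * f x + ereal u * f z"
      using conv that by (simp add: convex_ereal_def)
    then show ?thesis by (simp add: f_eq)
  qed
  have g_deriv: "(g has_derivative (\<lambda>h. inner h w)) (at x)"
    using grad by (simp add: has_gradient_at_def gderiv_def g_def[abs_def])
  define l where "l u = x + u *\<^sub>R (z - x)" for u :: real
  have "(l has_derivative (\<lambda>h. h *\<^sub>R (z - x))) (at 0 within {0<..})"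
    unfolding l_def by (auto intro!: derivative_eq_intros)
  moreover have "(g has_derivative (\<lambda>h. inner h w)) (at (l 0))" using g_deriv by (simp add: l_def)
  ultimately have "((\<lambda>u. g (l u)) has_derivative (\<lambda>h. inner (h *\<^sub>R (z - x)) w)) (at 0 within {0<..})"
    by (rule has_derivative_compose)
  then have "((\<lambda>u. g (l u)) has_field_derivative inner w (z - x)) (at 0 within {0<..})"
    by (simp add: has_field_derivative_def inner_commute mult_commute_abs)
  then have "((\<lambda>u. (g (l u) - g (l 0)) / (u - 0)) \<longlongrightarrow> inner w (z - x)) (at_right 0)"
    by (simp add: has_field_derivative_iff)
  moreover have "\<forall>\<^sub>F u in at_right (0::real). (g (l u) - g (l 0)) / (u - 0) \<le> g z - g x"
    using eventually_at_right_real[of 0 1]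
  proof (rule eventually_mono)
    fix u :: real assume u: "u \<in> {0<..<1}"
    have "l u = (1 - u) *\<^sub>R x + u *\<^sub>R z" by (simp add: l_def algebra_simps)
    then have "g (l u) - g (l 0) \<le> u * (g z - g x)"
      using conv_g[of u] u by (simp add: l_def algebra_simps)
    then show "(g (l u) - g (l 0)) / (u - 0) \<le> g z - g x" using u by (simp add: field_simps)
  qed simp
  ultimately have "inner w (z - x) \<le> g z - g x" by (rule tendsto_upperbound) simp
  then show ?thesis by (simp add: g_def)
qed

subsection \<open>The map sending a to norm(a)^m a\<close>

text \<open>The mean value bound for powers, multiplied by \<open>a\<close> to avoid the exponent
  \<open>m - 1\<close>, which would be truncated at \<open>m = 0\<close>.\<close>

lemma power_diff_mult_le:
  fixes a b :: real
  assumes "0 \<le> b" "b \<le> a"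
  shows "(a ^ m - b ^ m) * a \<le> real m * (a - b) * a ^ m"
proof (induction m)
  case (Suc m)
  have "(a ^ Suc m - b ^ Suc m) * a = a * ((a ^ m - b ^ m) * a) + (a - b) * a * b ^ m"
    by (simp add: algebra_simps)
  also have "\<dots> \<le> a * (real m * (a - b) * a ^ m) + (a - b) * a * a ^ m"
    using assms by (intro add_mono mult_left_mono Suc power_mono) auto
  also have "\<dots> = real (Suc m) * (a - b) * a ^ Suc m" by (simp add: algebra_simps)
  finally show ?case .
qed simp

text \<open>With \<open>?s\<close> and \<open>?e\<close> the mean and half difference of the
  weights, the vector equals \<open>?s *\<^sub>R (a - b) + ?e *\<^sub>R (a + b)\<close>, and
  \<open>power_diff_mult_le\<close> controls the second term. The mean weight is kept as a factor so
  that it can cancel against the one in \<open>inner_power_scaleR_diff_ge\<close>.\<close>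

lemma norm_power_scaleR_diff_le:
  fixes a b :: "'a::real_inner"
  shows "norm (norm a ^ m *\<^sub>R a - norm b ^ m *\<^sub>R b)
    \<le> (2 * real m + 1) * ((norm a ^ m + norm b ^ m) / 2) * norm (a - b)"
proof -
  have *: "norm (norm a ^ m *\<^sub>R a - norm b ^ m *\<^sub>R b)
      \<le> (2 * real m + 1) * ((norm a ^ m + norm b ^ m) / 2) * norm (a - b)"
    if "norm b \<le> norm a" for a b :: 'a
  proof -
    let ?s = "(norm a ^ m + norm b ^ m) / 2" and ?e = "(norm a ^ m - norm b ^ m) / 2"
    have pos: "?e \<ge> 0" using that by (simp add: power_mono)
    have "\<alpha> *\<^sub>R (a - b) + \<beta> *\<^sub>R (a + b) = (\<alpha> + \<beta>) *\<^sub>R a - (\<alpha> - \<beta>) *\<^sub>R b" for \<alpha> \<beta>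
      by (simp add: algebra_simps)
    moreover have "?s + ?e = norm a ^ m" "?s - ?e = norm b ^ m" by (simp_all add: field_simps)
    ultimately have "norm a ^ m *\<^sub>R a - norm b ^ m *\<^sub>R b = ?s *\<^sub>R (a - b) + ?e *\<^sub>R (a + b)"
      by metis
    then have "norm (norm a ^ m *\<^sub>R a - norm b ^ m *\<^sub>R b) \<le> norm (?s *\<^sub>R (a - b)) + norm (?e *\<^sub>R (a + b))"
      using norm_triangle_ineq by metis
    also have "\<dots> = ?s * norm (a - b) + ?e * norm (a + b)"
      using pos by simp
    also have "?e * norm (a + b) \<le> ?e * (2 * norm a)"
      using pos that norm_triangle_ineq[of a b] by (intro mult_left_mono) linarith+
    also have "\<dots> = (norm a ^ m - norm b ^ m) * norm a" by simp
    also have "\<dots> \<le> real m * (norm a - norm b) * norm a ^ m"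
      using that by (intro power_diff_mult_le) auto
    also have "\<dots> \<le> real m * norm (a - b) * (2 * ?s)"
      using norm_triangle_ineq2[of a b] that by (intro mult_mono) auto
    also have "?s * norm (a - b) + real m * norm (a - b) * (2 * ?s) = (2 * real m + 1) * ?s * norm (a - b)"
      by (simp only: ring_distribs) simp
    finally show ?thesis by simp
  qed
  show ?thesis
  proof (cases "norm b \<le> norm a")
    case False
    then show ?thesis using *[of a b] by (simp add: norm_minus_commute add.commute)
  qed (rule *)
qed

text \<open>The discarded remainder is a product of two differences of equal sign, both powers being
  monotone in the norm.\<close>

lemma inner_power_scaleR_diff_ge:
  fixes a b :: "'a::real_inner"
  shows "(norm a ^ m + norm b ^ m) / 2 * (norm (a - b))\<^sup>2
    \<le> inner (norm a ^ m *\<^sub>R a - norm b ^ m *\<^sub>R b) (a - b)"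
proof -
  have "inner (norm a ^ m *\<^sub>R a - norm b ^ m *\<^sub>R b) (a - b)
      = (norm a ^ m + norm b ^ m) / 2 * (norm (a - b))\<^sup>2
        + (norm a ^ m - norm b ^ m) * ((norm a)\<^sup>2 - (norm b)\<^sup>2) / 2"
    by (simp add: power2_norm_eq_inner inner_diff_left inner_diff_right inner_commute field_simps)
  moreover have "(norm a ^ m - norm b ^ m) * ((norm a)\<^sup>2 - (norm b)\<^sup>2) \<ge> 0"
    by (cases "norm a \<le> norm b") (auto simp: zero_le_mult_iff power_mono)
  ultimately show ?thesis by simp
qed

text \<open>Here \<open>va - a\<close> and \<open>vb - b\<close> play the role of the points \<open>x\<close> at two times, \<open>a\<close> and \<open>b\<close> that of \<open>r\<close>.\<close>

lemma power_resolvent_lipschitz: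
  fixes a b va vb :: "'a::real_inner"
  assumes "a \<noteq> 0"
    and mono: "inner (norm a ^ m *\<^sub>R a - norm b ^ m *\<^sub>R b) ((va - a) - (vb - b)) \<ge> 0"
  shows "norm (a - b) \<le> (2 * real m + 1) * norm (va - vb)"
proof (cases "a = b")
  case False
  define s where "s = (norm a ^ m + norm b ^ m) / 2"
  define D where "D = norm a ^ m *\<^sub>R a - norm b ^ m *\<^sub>R b"
  have "s > 0" using \<open>a \<noteq> 0\<close> by (simp add: s_def add_pos_nonneg)
  have "s * (norm (a - b))\<^sup>2 \<le> inner D (a - b)"
    unfolding s_def D_def by (rule inner_power_scaleR_diff_ge)
  also have "\<dots> \<le> inner D (va - vb)" using mono by (simp add: D_def[symmetric] inner_diff_right)
  also have "\<dots> \<le> norm D * norm (va - vb)" by (rule norm_cauchy_schwarz)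
  also have "\<dots> \<le> (2 * real m + 1) * s * norm (a - b) * norm (va - vb)"
    unfolding s_def D_def by (intro mult_right_mono norm_power_scaleR_diff_le) simp
  finally have "(s * norm (a - b)) * norm (a - b) \<le> (s * norm (a - b)) * ((2 * real m + 1) * norm (va - vb))"
    by (simp add: power2_eq_square mult_ac)
  \<comment> \<open>The weight \<open>s\<close> cancels, so the Lipschitz constant does not depend
    on the sizes of \<open>a\<close> and \<open>b\<close>.\<close>
  then show ?thesis using \<open>s > 0\<close> False by simp
qed simp

lemma rescaled_eq_0_iff [simp]: "rescaled p F x = 0 \<longleftrightarrow> F x = 0"
  by (simp add: rescaled_def)

text \<open>The rescaled vector has norm \<open>n powr (1 / p)\<close>, whose power
  \<open>p - 1\<close> is exactly the denominator in \<open>rescaled\<close>.\<close>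

lemma rescaled_inverse:
  assumes "p \<ge> 1"
  shows "norm (rescaled p F x) ^ (p - 1) *\<^sub>R rescaled p F x = F x"
proof (cases "F x = 0")
  case False
  define n where "n = norm (F x)"
  have n: "n > 0" using False by (simp add: n_def)
  have "norm (rescaled p F x) = n powr 1 / n powr (1 - 1 / real p)"
    using n by (simp add: rescaled_def n_def divide_inverse mult.commute)
  also have "\<dots> = n powr (1 / real p)" by (simp only: powr_diff[symmetric]) simp
  finally have "norm (rescaled p F x) ^ (p - 1) = n powr ((1 / real p) * real (p - 1))"
    using n by (simp add: powr_powr flip: powr_realpow)
  also have "(1 / real p) * real (p - 1) = 1 - 1 / real p"
    using assms by (simp add: of_nat_diff field_simps)
  finally show ?thesis using n by (simp add: rescaled_def flip: n_def)
qed simp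

subsection \<open>Trajectories\<close>

locale arg_trajectory =
  fixes F :: "'a::{real_inner, complete_space} \<Rightarrow> 'a"
    and p :: nat and x0 :: 'a and x v s :: "real \<Rightarrow> 'a"
  assumes cont: "continuous_on UNIV F"
    and mono: "monotone_operator F"
    and p: "p \<ge> 1"
    and sol: "arg_global_solution p F x0 x v s"
begin

section \<open>The system rewritten in terms of \<open>r\<close>\<close>

definition r :: "real \<Rightarrow> 'a" where "r t = rescaled p F (x t)"

lemma x_eq: "t \<ge> 0 \<Longrightarrow> x t = v t - r t"
  using sol by (auto simp: arg_global_solution_def r_def algebra_simps)

lemma F_eq: "F (x t) = norm (r t) ^ (p - 1) *\<^sub>R r t"
  by (simp only: r_def rescaled_inverse[OF p])

lemma r_nonzero: "t \<ge> 0 \<Longrightarrow> r t \<noteq> 0"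
  using sol by (auto simp: arg_global_solution_def r_def)

lemma v_deriv: "t \<ge> 0 \<Longrightarrow> (v has_vector_derivative - r t) (at t within {0..})"
proof -
  assume t: "t \<ge> 0"
  have "((\<lambda>t. x0 + s t) has_vector_derivative - r t) (at t within {0..})"
    using sol t by (auto simp: arg_global_solution_def r_def intro!: derivative_eq_intros)
  then show ?thesis
    by (rule has_vector_derivative_transform[rotated 2]) (use sol t in \<open>auto simp: arg_global_solution_def\<close>)
qed

section \<open>Fejer monotonicity with respect to the zeros\<close>

text \<open>Monotonicity at \<open>x t\<close> and \<open>z\<close>, divided by the positive factor
  \<open>norm (r t) ^ (p - 1)\<close>, gives \<open>inner (r t) (x t - z) \<ge> 0\<close>; then
  substitute \<open>x t = v t - r t\<close>.\<close>

lemma r_sq_le_inner: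
  assumes "F z = 0" "t \<ge> 0"
  shows "(norm (r t))\<^sup>2 \<le> inner (r t) (v t - z)"
proof -
  have "inner (F (x t) - F z) (x t - z) \<ge> 0" using mono by (simp add: monotone_operator_def)
  then have "norm (r t) ^ (p - 1) * inner (r t) (x t - z) \<ge> 0" by (simp add: F_eq assms)
  moreover have "norm (r t) ^ (p - 1) > 0" using r_nonzero assms by simp
  ultimately have "inner (r t) (x t - z) \<ge> 0" by (simp add: zero_le_mult_iff)
  then show ?thesis
    by (simp add: x_eq assms inner_diff_right power2_norm_eq_inner)
qed

lemma dist_sq_deriv:
  assumes "t \<ge> 0"
  shows "((\<lambda>t. (norm (v t - z))\<^sup>2) has_real_derivative - 2 * inner (r t) (v t - z)) (at t within {0..})"
proof -
  have "(v has_derivative (\<lambda>h. h *\<^sub>R - r t)) (at t within {0..})"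
    using v_deriv[OF assms] by (simp add: has_vector_derivative_def)
  then have "((\<lambda>t. inner (v t - z) (v t - z)) has_derivative
      (\<lambda>h. inner (v t - z) (h *\<^sub>R - r t) + inner (h *\<^sub>R - r t) (v t - z))) (at t within {0..})"
    by (auto intro!: derivative_eq_intros)
  then show ?thesis
    unfolding has_field_derivative_def power2_norm_eq_inner
    by (rule has_derivative_eq_rhs) (auto simp: fun_eq_iff inner_commute)
qed

text \<open>Integrates \<open>dist_sq_deriv\<close> using \<open>r_sq_le_inner\<close>. The case
  \<open>k = 0\<close> is Fejer monotonicity; a positive \<open>k\<close> measures the loss while
  \<open>r\<close> stays away from 0.\<close>

lemma dist_sq_decrease:
  assumes z: "F z = 0" and ab: "0 \<le> a" "a \<le> b" and k: "0 \<le> k"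
    and r: "\<And>t. a \<le> t \<Longrightarrow> t \<le> b \<Longrightarrow> k \<le> norm (r t)"
  shows "(norm (v b - z))\<^sup>2 + 2 * k\<^sup>2 * (b - a) \<le> (norm (v a - z))\<^sup>2"
proof -
  define g where "g t = (norm (v t - z))\<^sup>2 + 2 * k\<^sup>2 * t" for t
  have d: "(g has_real_derivative - 2 * inner (r t) (v t - z) + 2 * k\<^sup>2) (at t within {0..})" if "t \<ge> 0" for t
    unfolding g_def by (rule derivative_eq_intros dist_sq_deriv that refl | simp)+
  have "g b \<le> g a"
  \<comment> \<open>The derivative at time 0 is only one-sided, hence open interval plus
    continuity.\<close>
  proof (rule DERIV_nonpos_imp_decreasing_open[OF ab(2)])
    fix t assume t: "a < t" "t < b"
    then have "at t within {0..} = at t" using ab by (intro at_within_interior) auto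
    moreover have "k\<^sup>2 \<le> inner (r t) (v t - z)"
      using power_mono[OF r k, of t 2] r_sq_le_inner[OF z, of t] t ab by simp
    ultimately show "\<exists>y. DERIV g t :> y \<and> y \<le> 0" using d[of t] t ab by auto
  next
    have "continuous_on {0..} g"
      using d by (auto intro!: DERIV_continuous_on)
    then show "continuous_on {a..b} g" by (rule continuous_on_subset) (use ab in auto)
  qed
  then show ?thesis by (simp add: g_def algebra_simps)
qed

lemma dist_antimono:
  assumes "F z = 0" "0 \<le> a" "a \<le> b"
  shows "norm (v b - z) \<le> norm (v a - z)"
  using dist_sq_decrease[OF assms, of 0] by (simp add: power2_le_iff_abs_le)

lemma dist_convergent:
  assumes z: "F z = 0"
  shows "\<exists>l. ((\<lambda>t. norm (v t - z)) \<longlongrightarrow> l) at_top"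
proof -
  define A where "A = (\<lambda>t. norm (v t - z)) ` {0..}"
  have A: "A \<noteq> {}" "bdd_below A" by (auto simp: A_def intro!: bdd_belowI[of _ 0])
  have "((\<lambda>t. norm (v t - z)) \<longlongrightarrow> Inf A) at_top"
  proof (rule decreasing_tendsto)
    show "\<forall>\<^sub>F t in at_top. Inf A \<le> norm (v t - z)"
      using eventually_ge_at_top[of "0::real"]
      by eventually_elim (auto simp: A_def intro!: cInf_lower A(2)[unfolded A_def])
  next
    fix y assume "Inf A < y"
    then obtain a where a: "a \<ge> 0" "norm (v a - z) < y"
      using cInf_lessD[OF A(1)] by (auto simp: A_def)
    show "\<forall>\<^sub>F t in at_top. norm (v t - z) < y"
      using eventually_ge_at_top[of a]
      by eventually_elim (use dist_antimono[OF z a(1)] a(2) in fastforce)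
  qed
  then show ?thesis by blast
qed

section \<open>Lipschitz bounds in time and decay of \<open>r\<close>\<close>

lemma norm_r_le:
  assumes "F z = 0" "t \<ge> 0"
  shows "norm (r t) \<le> norm (v 0 - z)"
proof -
  have "norm (r t) * norm (r t) \<le> inner (r t) (v t - z)"
    using r_sq_le_inner[OF assms] by (simp add: power2_eq_square)
  also have "\<dots> \<le> norm (r t) * norm (v t - z)" by (rule norm_cauchy_schwarz)
  finally have "norm (r t) \<le> norm (v t - z)" using r_nonzero[OF assms(2)] by simp
  also have "\<dots> \<le> norm (v 0 - z)" using dist_antimono[OF assms(1) _ assms(2)] by simp
  finally show ?thesis .
qed

lemma v_lipschitz:
  assumes "F z = 0" "a \<ge> 0" "b \<ge> 0"
  shows "norm (v a - v b) \<le> norm (v 0 - z) * \<bar>a - b\<bar>"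
proof -
  have "norm (v a - v b) \<le> norm (v 0 - z) * norm (a - b)"
  proof (rule differentiable_bound[where S="{0..}" and f'="\<lambda>t h. h *\<^sub>R - r t"])
    fix t :: real assume t: "t \<in> {0..}"
    then show "(v has_derivative (\<lambda>h. h *\<^sub>R - r t)) (at t within {0..})"
      using v_deriv by (simp add: has_vector_derivative_def)
    show "onorm (\<lambda>h. h *\<^sub>R - r t) \<le> norm (v 0 - z)"
      using norm_r_le[OF assms(1), of t] t
      by (intro onorm_le) (auto simp: mult.commute intro!: mult_left_mono)
  qed (use assms in auto)
  then show ?thesis by simp
qed

text \<open>Monotonicity at \<open>x a\<close> and \<open>x b\<close>, expressed through
  \<open>r\<close> and \<open>v\<close>, is the hypothesis of
  \<open>power_resolvent_lipschitz\<close> for \<open>m = p - 1\<close>.\<close>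

lemma r_lipschitz_v:
  assumes "a \<ge> 0" "b \<ge> 0"
  shows "norm (r a - r b) \<le> (2 * real (p - 1) + 1) * norm (v a - v b)"
proof (rule power_resolvent_lipschitz)
  have "inner (F (x a) - F (x b)) (x a - x b) \<ge> 0" using mono by (simp add: monotone_operator_def)
  then show "0 \<le> inner (norm (r a) ^ (p - 1) *\<^sub>R r a - norm (r b) ^ (p - 1) *\<^sub>R r b) (v a - r a - (v b - r b))"
    by (simp only: F_eq) (simp only: x_eq assms)
qed (use r_nonzero assms in auto)

text \<open>A Barbalat argument. If \<open>norm (r t) \<ge> e\<close>, the Lipschitz bound keeps
  \<open>norm (r u)\<close> above \<open>e / 2\<close> for a fixed time \<open>\<eta>\<close>, so
  the squared distance to \<open>z\<close> drops by a fixed amount. As it converges, this stops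
  happening.\<close>

lemma r_tendsto_0:
  assumes z: "F z = 0"
  shows "(r \<longlongrightarrow> 0) at_top"
proof (rule tendstoI)
  fix e :: real assume e: "e > 0"
  \<comment> \<open>The added 1 makes \<open>C\<close> positive whatever \<open>v 0 - z\<close>
    is.\<close>
  define C where "C = (2 * real (p - 1) + 1) * norm (v 0 - z) + 1"
  have C: "C > 0" by (simp add: C_def add_nonneg_pos)
  have r_lip: "norm (r a - r b) \<le> C * \<bar>a - b\<bar>" if "a \<ge> 0" "b \<ge> 0" for a b
  proof -
    have "norm (r a - r b) \<le> (2 * real (p - 1) + 1) * (norm (v 0 - z) * \<bar>a - b\<bar>)"
      using r_lipschitz_v[OF that] v_lipschitz[OF z that]
      by (meson mult_left_mono order_trans add_nonneg_nonneg of_nat_0_le_iff zero_le_one zero_le_mult_iff zero_le_numeral)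
    also have "\<dots> \<le> C * \<bar>a - b\<bar>" by (simp add: C_def algebra_simps)
    finally show ?thesis .
  qed
  define \<eta> where "\<eta> = e / (2 * C)"
  have \<eta>: "\<eta> > 0" "C * \<eta> = e / 2" using e C by (auto simp: \<eta>_def)
  define E where "E t = (norm (v t - z))\<^sup>2" for t
  obtain l where l: "((\<lambda>t. norm (v t - z)) \<longlongrightarrow> l) at_top" using dist_convergent[OF z] by blast
  have E: "(E \<longlongrightarrow> l\<^sup>2) at_top" unfolding E_def by (intro tendsto_intros l)
  have "filterlim (\<lambda>t. t + \<eta>) at_top at_top"
    by (rule filterlim_at_top_mono[OF filterlim_ident]) (use \<eta> in auto)
  from tendsto_diff[OF E filterlim_compose[OF E this]]
  have "((\<lambda>t. E t - E (t + \<eta>)) \<longlongrightarrow> 0) at_top" by simp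
  then have "\<forall>\<^sub>F t in at_top. E t - E (t + \<eta>) < 2 * (e / 2)\<^sup>2 * \<eta>"
    by (rule order_tendstoD) (use e \<eta> in simp)
  then show "\<forall>\<^sub>F t in at_top. dist (r t) 0 < e"
    using eventually_ge_at_top[of "0::real"]
  proof eventually_elim
    case (elim t)
    show ?case
    proof (rule ccontr)
      assume "\<not> ?case"
      then have big: "norm (r t) \<ge> e" by simp
      have "e / 2 \<le> norm (r u)" if "t \<le> u" "u \<le> t + \<eta>" for u
      proof -
        have "norm (r t - r u) \<le> C * \<bar>t - u\<bar>" using r_lip[of t u] that elim by linarith
        also have "\<dots> \<le> C * \<eta>" using that C by (intro mult_left_mono) auto
        finally have "norm (r t - r u) \<le> e / 2" using \<eta> by simp
        then show ?thesis using big norm_triangle_ineq2[of "r t" "r u"] by linarith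
      qed
      then have "E (t + \<eta>) + 2 * (e / 2)\<^sup>2 * (t + \<eta> - t) \<le> E t"
        unfolding E_def using elim \<eta> e by (intro dist_sq_decrease[OF z]) auto
      then show False using elim by simp
    qed
  qed
qed

section \<open>From the decay of \<open>r\<close> to weak convergence\<close>

lemma F_tendsto_0:
  assumes "F z = 0"
  shows "((\<lambda>t. F (x t)) \<longlongrightarrow> 0) at_top"
proof -
  have "((\<lambda>t. norm (r t) ^ (p - 1) *\<^sub>R r t) \<longlongrightarrow> norm (0::'a) ^ (p - 1) *\<^sub>R 0) at_top"
    by (intro tendsto_intros r_tendsto_0[OF assms])
  then show ?thesis by (simp add: F_eq)
qed

lemma norm_x_le:
  assumes "F z = 0" "t \<ge> 0"
  shows "norm (x t) \<le> 2 * norm (v 0 - z) + norm z"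
proof -
  have "x t = (v t - z) - r t + z" by (simp add: x_eq assms)
  then have "norm (x t) \<le> norm (v t - z) + norm (r t) + norm z"
    using norm_triangle_ineq[of "v t - z - r t" z] norm_triangle_ineq4[of "v t - z" "r t"] by simp
  then show ?thesis using norm_r_le[OF assms] dist_antimono[OF assms(1) _ assms(2)] by simp
qed

lemma x_minus_v_tendsto_0:
  assumes "F z = 0"
  shows "((\<lambda>t. x t - v t) \<longlongrightarrow> 0) at_top"
proof (rule Lim_transform_eventually)
  show "((\<lambda>t. - r t) \<longlongrightarrow> 0) at_top" using tendsto_minus[OF r_tendsto_0[OF assms]] by simp
  show "\<forall>\<^sub>F t in at_top. - r t = x t - v t"
    using eventually_ge_at_top[of "0::real"] by eventually_elim (simp add: x_eq)
qed

text \<open>Opial's lemma for the set of zeros: limits at infinity persist along finer filters, so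
  \<open>asymptotic_hull_point_zero\<close> applies to each of them.\<close>

lemma v_weakly_convergent:
  assumes z: "F z = 0"
  shows "\<exists>c\<in>{z. F z = 0}. weakly_tendsto v c at_top"
proof (rule opial_weak_limit)
  fix G' c assume "G' \<le> (at_top :: real filter)" and hull: "asymptotic_hull_point v G' c"
  have ev: "\<forall>\<^sub>F t in at_top. norm (x t) \<le> 2 * norm (v 0 - z) + norm z"
    using eventually_ge_at_top[of "0::real"] by eventually_elim (rule norm_x_le[OF z])
  show "c \<in> {z. F z = 0}"
    using asymptotic_hull_point_zero[OF cont mono hull]
      tendsto_mono[OF \<open>G' \<le> at_top\<close> x_minus_v_tendsto_0[OF z]]
      tendsto_mono[OF \<open>G' \<le> at_top\<close> F_tendsto_0[OF z]] filter_leD[OF \<open>G' \<le> at_top\<close> ev]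
    by blast
qed (use z dist_convergent in auto)

section \<open>Transfer of limits between \<open>x\<close> and \<open>v\<close>, and strong
  convergence\<close>

lemma v_strong_of_x_strong:
  assumes "F z = 0" "(x \<longlongrightarrow> c) at_top"
  shows "(v \<longlongrightarrow> c) at_top"
  using tendsto_diff[OF assms(2) x_minus_v_tendsto_0[OF assms(1)]] by simp

lemma x_strong_of_v_strong:
  assumes "F z = 0" "(v \<longlongrightarrow> c) at_top"
  shows "(x \<longlongrightarrow> c) at_top"
  using tendsto_add[OF x_minus_v_tendsto_0[OF assms(1)] assms(2)] by simp

lemma x_weakly_tendsto:
  assumes "F z = 0" "weakly_tendsto v c at_top"
  shows "weakly_tendsto x c at_top"
  unfolding weakly_tendsto_def
proof
  fix y
  have "((\<lambda>t. inner (v t) y) \<longlongrightarrow> inner c y) at_top" using assms(2) by (simp add: weakly_tendsto_def)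
  from tendsto_add[OF tendsto_inner[OF x_minus_v_tendsto_0[OF assms(1)] tendsto_const] this]
  have "((\<lambda>t. inner (x t - v t) y + inner (v t) y) \<longlongrightarrow> inner 0 y + inner c y) at_top" .
  then show "((\<lambda>t. inner (x t) y) \<longlongrightarrow> inner c y) at_top" by (simp add: inner_diff_left)
qed

text \<open>Since \<open>v\<close> is Fejer monotone with respect to all points of a ball of zeros, comparing with the
  point of the ball shifted in the direction \<open>v a - v b\<close> bounds the displacement.\<close>

lemma displacement_le:
  assumes ball: "cball z \<rho> \<subseteq> {z. F z = 0}" and \<rho>: "\<rho> \<ge> 0" and ab: "0 \<le> a" "a \<le> b"
  shows "2 * \<rho> * norm (v a - v b) \<le> (norm (v a - z))\<^sup>2 - (norm (v b - z))\<^sup>2"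
proof -
  \<comment> \<open>Since \<open>sgn 0 = 0\<close>, the shift vanishes when
    \<open>v a = v b\<close>.\<close>
  define w where "w = \<rho> *\<^sub>R sgn (v a - v b)"
  have "z + w \<in> cball z \<rho>" using \<rho> by (simp add: w_def dist_norm norm_sgn)
  then have "F (z + w) = 0" using ball by auto
  then have "(norm (v b - (z + w)))\<^sup>2 \<le> (norm (v a - (z + w)))\<^sup>2"
    by (intro power_mono dist_antimono ab) auto
  then have "2 * inner (v a - v b) w \<le> (norm (v a - z))\<^sup>2 - (norm (v b - z))\<^sup>2"
    by (simp add: power2_norm_eq_inner inner_diff_left inner_diff_right inner_add_left
        inner_add_right inner_commute algebra_simps)
  moreover have "inner (v a - v b) w = \<rho> * norm (v a - v b)"
    by (cases "v a = v b")
      (simp_all add: w_def sgn_div_norm power2_norm_eq_inner[symmetric] power2_eq_square)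
  ultimately show ?thesis by simp
qed

text \<open>Pair the displacement \<open>v a - v b\<close> with \<open>v a - c\<close> and let
  \<open>b\<close> tend to infinity: weak convergence turns \<open>displacement_le\<close> into
  \<open>norm (v a - c) \<le> \<delta> a\<close>, and \<open>\<delta>\<close> tends to 0.\<close>

lemma v_strong_of_interior:
  assumes weak: "weakly_tendsto v c at_top" and int: "interior {z. F z = 0} \<noteq> {}"
  shows "(v \<longlongrightarrow> c) at_top"
proof -
  obtain z \<rho> where \<rho>: "\<rho> > 0" and ball: "cball z \<rho> \<subseteq> {z. F z = 0}"
    using int by (auto simp: mem_interior_cball)
  have z: "F z = 0" using subsetD[OF ball, of z] \<rho> by simp
  obtain l where l: "((\<lambda>t. norm (v t - z)) \<longlongrightarrow> l) at_top" using dist_convergent[OF z] by blast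
  define \<delta> where "\<delta> t = ((norm (v t - z))\<^sup>2 - l\<^sup>2) / (2 * \<rho>)" for t
  have "norm (v a - c) \<le> \<delta> a" if a: "a \<ge> 0" for a
  proof -
    let ?n = "norm (v a - c)"
    have "((\<lambda>b. inner (v a) (v a - c) - inner (v b) (v a - c)) \<longlongrightarrow> inner (v a) (v a - c) - inner c (v a - c)) at_top"
      using weak by (intro tendsto_diff tendsto_const) (simp add: weakly_tendsto_def)
    moreover have "((\<lambda>b. ((norm (v a - z))\<^sup>2 - (norm (v b - z))\<^sup>2) / (2 * \<rho>) * ?n) \<longlongrightarrow> \<delta> a * ?n) at_top"
      unfolding \<delta>_def by (intro tendsto_intros l) (use \<rho> in simp)
    moreover have "\<forall>\<^sub>F b in at_top. inner (v a) (v a - c) - inner (v b) (v a - c)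
        \<le> ((norm (v a - z))\<^sup>2 - (norm (v b - z))\<^sup>2) / (2 * \<rho>) * ?n"
      using eventually_ge_at_top[of a]
    proof eventually_elim
      case (elim b)
      have "inner (v a) (v a - c) - inner (v b) (v a - c) \<le> norm (v a - v b) * ?n"
        using norm_cauchy_schwarz[of "v a - v b" "v a - c"] by (simp add: inner_diff_left)
      also have "norm (v a - v b) \<le> ((norm (v a - z))\<^sup>2 - (norm (v b - z))\<^sup>2) / (2 * \<rho>)"
        using displacement_le[OF ball _ a elim] \<rho> by (simp add: field_simps)
      finally show ?case by (simp add: mult_right_mono)
    qed
    ultimately have "inner (v a) (v a - c) - inner c (v a - c) \<le> \<delta> a * ?n"
      by (intro tendsto_le[OF trivial_limit_at_top_linorder])
    then have "?n * ?n \<le> \<delta> a * ?n"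
      by (simp add: inner_diff_left[symmetric] power2_norm_eq_inner[symmetric] power2_eq_square)
    \<comment> \<open>Covers the case \<open>?n = 0\<close>, where the factor \<open>?n\<close>
      cannot be cancelled.\<close>
    moreover have "\<delta> a \<ge> 0"
    proof -
      have "l \<le> norm (v a - z)"
        by (rule tendsto_upperbound[OF l])
          (auto intro!: eventually_mono[OF eventually_ge_at_top[of a]] dist_antimono z a)
      moreover have "l \<ge> 0" by (rule tendsto_lowerbound[OF l]) auto
      ultimately show ?thesis using \<rho> by (simp add: \<delta>_def power_mono)
    qed
    ultimately show ?thesis by (cases "?n = 0") auto
  qed
  then have "\<forall>\<^sub>F a in at_top. norm (v a - c) \<le> \<delta> a"
    by (rule eventually_mono[OF eventually_ge_at_top[of "0::real"]])
  moreover have "(\<delta> \<longlongrightarrow> (l\<^sup>2 - l\<^sup>2) / (2 * \<rho>)) at_top"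
    unfolding \<delta>_def by (intro tendsto_intros l) (use \<rho> in simp)
  ultimately have "((\<lambda>t. v t - c) \<longlongrightarrow> 0) at_top"
    using Lim_null_comparison[of "\<lambda>t. v t - c" \<delta> at_top] by simp
  then show ?thesis by (simp add: LIM_zero_iff)
qed

text \<open>The tangent inequality at \<open>x t\<close>, evaluated at \<open>z\<close>, bounds
  \<open>f (x t)\<close> because \<open>F (x t)\<close> tends to 0 and \<open>x\<close> is bounded.
  Thus \<open>x\<close> eventually lies in a compact set, where weak convergence is strong.\<close>

lemma x_strong_of_inf_compact:
  fixes f :: "'a \<Rightarrow> ereal"
  assumes weak: "weakly_tendsto x c at_top" and z: "F z = 0"
    and conv: "convex_ereal f" and comp: "inf_compact f" and grad: "\<And>z. has_gradient_at f (F z) z"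
  shows "(x \<longlongrightarrow> c) at_top"
proof -
  have fin: "\<bar>f y\<bar> \<noteq> \<infinity>" for y
    using grad[of y] by (auto simp: has_gradient_at_def dest: eventually_nhds_x_imp_x)
  \<comment> \<open>Bounds \<open>norm (x t - z)\<close>: the bound of \<open>norm_x_le\<close> plus
    one more \<open>norm z\<close>.\<close>
  define B where "B = 2 * norm (v 0 - z) + norm z + norm z"
  define \<kappa> where "\<kappa> = real_of_ereal (f z) + B"
  have "\<forall>\<^sub>F t in at_top. norm (F (x t)) < 1"
    using tendsto_norm[OF F_tendsto_0[OF z]] by (rule order_tendstoD) simp
  then have "\<forall>\<^sub>F t in at_top. x t \<in> closure {y. f y \<le> ereal \<kappa>}"
    using eventually_ge_at_top[of "0::real"]
  proof eventually_elim
    case (elim t)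
    have "real_of_ereal (f (x t)) \<le> real_of_ereal (f z) + inner (F (x t)) (x t - z)"
      using convex_ereal_above_tangent[OF conv fin grad, of "x t" z] by (simp add: inner_diff_right)
    also have "inner (F (x t)) (x t - z) \<le> norm (F (x t)) * norm (x t - z)"
      by (rule norm_cauchy_schwarz)
    also have "\<dots> \<le> 1 * B"
      using elim norm_x_le[OF z, of t] norm_triangle_ineq4[of "x t" z]
      by (intro mult_mono) (auto simp: B_def)
    finally have "real_of_ereal (f (x t)) \<le> \<kappa>" by (simp add: \<kappa>_def)
    then have "f (x t) \<le> ereal \<kappa>" using fin[of "x t"] by (cases "f (x t)") auto
    then show ?case by (intro subsetD[OF closure_subset]) simp
  qed
  moreover have "compact (closure {y. f y \<le> ereal \<kappa>})" using comp by (simp add: inf_compact_def)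
  ultimately show ?thesis using weakly_tendsto_in_compact_imp_tendsto[OF weak] by blast
qed

end

theorem theorem2p4:
  fixes F :: "'a::{real_inner, complete_space} \<Rightarrow> 'a"
    and p :: nat
    and x0 :: 'a
    and x v s :: "real \<Rightarrow> 'a"
  assumes "continuous_on UNIV F"
    and "monotone_operator F"
    and "\<exists>z. F z = 0"
    and "p \<ge> 1"
    and "F x0 \<noteq> 0"
    and "arg_global_solution p F x0 x v s"
  shows "\<exists>xbar \<in> {z. F z = 0}.
           weakly_tendsto x xbar at_top \<and> weakly_tendsto v xbar at_top \<and>
           ((\<exists>f :: 'a \<Rightarrow> ereal. convex_ereal f \<and> inf_compact f \<and> (\<forall>z. has_gradient_at f (F z) z))
              \<or> interior {z. F z = 0} \<noteq> {}
            \<longrightarrow> (x \<longlongrightarrow> xbar) at_top \<and> (v \<longlongrightarrow> xbar) at_top)"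
proof -
  interpret arg_trajectory F p x0 x v s using assms by unfold_locales
  obtain z where z: "F z = 0" using assms(3) by blast
  obtain c where c: "c \<in> {z. F z = 0}" and v: "weakly_tendsto v c at_top"
    using v_weakly_convergent[OF z] by blast
  have x: "weakly_tendsto x c at_top" by (rule x_weakly_tendsto[OF z v])
  \<comment> \<open>Nonempty interior gives the strong limit of \<open>v\<close>, inf-compactness
    that of \<open>x\<close>; each is then transferred to the other trajectory.\<close>
  show ?thesis
    using c v x v_strong_of_interior[OF v] x_strong_of_v_strong[OF z]
      x_strong_of_inf_compact[OF x z] v_strong_of_x_strong[OF z] by blast
qed

end
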